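(* Let $(A,\theta)$ be an independence alphabet. Every locally transitive finite factorization of $M(A,\theta)$ admits a bracketing.
   Context: Independence alphabets and TFSA. An independence alphabet $(A,\theta)$ is a set $A$ with a symmetric, antireflexive relation $\theta$. $M(A,\theta)=\langle A\mid ab=ba,\ (a,b)\in\theta\rangle$ is the free partially commutative monoid (elements: traces). $\mathrm{Alph}(t)$ is the set of letters of $t$; $IA(t)=\{a\in A\mid t=aw\text{ for some }w\}$. For $X\subset M(A,\theta)$, $\langle X\rangle$ is the submonoid generated by $X$ and $\theta_X=\{(x_1,x_2)\in X^2\mid\mathrm{Alph}(x_1)\times\mathrm{Alph}(x_2)\subset\theta\}$. $X$ is a partially commutative code if each trace of $\langle X\rangle$ has a unique decomposition on $X$ up to the commutations $\theta_X$, i.e. the natural map $M(X,\theta_X)\to\langle X\rangle$ is an isomorphism; then $\langle X\rangle$ is identified with $M(X,\theta_X)$. For $B\subset A$ and $Z=A\setminus B$, $\beta_Z(B)=\{zw\mid z\in Z,\ w\in M(B,\theta_B),\ IA(zw)=\{z\}\}$; $B$ is a transitively factorizing subalphabet (TFSA) of $A$ if $\beta_Z(B)$ is a partially commutative code. The same notions are used with $(Y,\theta_Y)$, $Y$ a partially commutative code, in place of $(A,\theta)$. Factorizations. A factorization of a monoid $M$ is a family $(M_i)_{i\in J}$ of submonoids, $J$ totally ordered, such that every $m\ne1$ in $M$ is uniquely $m=m_{i_1}\cdots m_{i_n}$ with $i_1<\dots<i_n$ and $m_{i_k}\in M_{i_k}\setminus\{1\}$. For $M=M(A,\theta)$ it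 is denoted by the family $(Y_i)_{i\in J}$ of minimal generating sets of its components, $M_i=\langle Y_i\rangle$; $\mathrm{Cont}\,\mathcal F=\bigcup_iY_i$. A factorization with two components is a bisection. If $\mathcal F'$ is a factorization of a component $M_k$ of $\mathcal F$, the composition $\mathcal F'\circ\mathcal F$ is obtained by replacing $M_k$ in $\mathcal F$ by the ordered family $\mathcal F'$. A transitive bisection of $M(A,\theta)$ is $(B,\beta_{A\setminus B}(B))$ with $B$ a TFSA of $A$. A (finite) transitive factorization is a factorization composed of finitely many transitive bisections. Locally transitive finite. For finite $B\subset A$ and $n\ge0$, $B^{\le n}$ is the set of traces of length $\le n$ over $B$. A factorization $\mathcal F=(Y_i)_{i\in I}$ of $M(A,\theta)$ is locally transitive finite if for every finite $B\subset A$ and every $n\ge0$ there are a finite transitive factorization $(Y'_i)_{i\in I'}$ of $M(A,\theta)$ and a strictly increasing map $\phi:I'\to I$ with $Y'_i\cap B^{\le n}=Y_{\phi(i)}\cap B^{\le n}$ for all $i\in I'$ and $Y_j\cap B^{\le n}=\emptyset$ for $j\notin\phi(I')$. Lie algebra. $K$ is a commutative ring with unit; $L_K(A,\theta)$ is the Lie subalgebra of $K[M(A,\theta)]$ (commutator bracket) generated by the letters, i.e. the free partially commutative Lie algebra. Bracketing of a finite transitive factorization. For a finite transitive factorization $\mathcal F=(Y_i)_{i\in[1,n+1]}$, $\widetilde{\mathcal F}$ is the set of $n$-tuples $\mathfrak f=(\mathbb B_1,\dots,\mathbb B_n)$ of transitive bisections with $\mathcal F=\mathbb B_n\circ\dots\circ\mathbb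 B_1$. For $\mathfrak f\in\widetilde{\mathcal F}$, the bracketing of $\mathcal F$ along $\mathfrak f$ is the map $\Pi_{\mathfrak f}:\mathrm{Cont}\,\mathcal F\to L_K(A,\theta)$ defined inductively as follows. If $n=1$, $\mathfrak f=((B,\beta_Z(B)))$ with $Z=A\setminus B$, and $\Pi_{\mathfrak f}(w)=w$ if $w\in B$, while $\Pi_{\mathfrak f}(w)=[\dots[z,b_1],\dots,b_k]$ if $w=zb_1\cdots b_k\in\beta_Z(B)$ with $z\in Z$ and $b_1,\dots,b_k\in B$. If $n>1$, let $\mathfrak f'=(\mathbb B_1,\dots,\mathbb B_{n-1})$, $\mathbb B_{n-1}\circ\dots\circ\mathbb B_1=(Y'_i)_{i\in[1,n]}$, and let $j\in[1,n]$ be such that $\mathbb B_n=(Y''_j,\beta_{Y'_j\setminus Y''_j}(Y''_j))$ is a bisection of $\langle Y'_j\rangle$. Then $\Pi_{\mathfrak f}(w)=\Pi_{\mathfrak f'}(w)$ if $w\in\bigcup_iY'_i$, and $\Pi_{\mathfrak f}(w)=[\dots[\Pi_{\mathfrak f'}(y_1),\Pi_{\mathfrak f'}(v_1)],\dots,\Pi_{\mathfrak f'}(v_k)]$ if $w=y_1v_1\cdots v_k\in\beta_{Y'_j\setminus Y''_j}(Y''_j)$ with $y_1\in Y'_j\setminus Y''_j$ and $v_1,\dots,v_k\in Y''_j$. Bracketing in the local case. A bracketing of a locally transitive finite factorization $\mathcal F=(Y_i)_{i\in J}$ of $M(A,\theta)$ is a map $\Pi:\bigcup_{i\in J}Y_i\to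 L_K(A,\theta)$ such that for each finite $B\subset A$ and each integer $n\ge0$ there exist a finite transitive factorization $\mathcal F_{n,B}$ of $M(A,\theta)$ and $\mathfrak f_{n,B}\in\widetilde{\mathcal F}_{n,B}$ such that $\Pi(t)=\Pi_{\mathfrak f_{n,B}}(t)$ for each $t\in\mathrm{Cont}\,\mathcal F_{n,B}\cap B^{\le n}$. *)

theory Defs
  imports "HOL-Algebra.Group" "HOL-Library.Poly_Mapping"
begin

definition monoid_prod :: "('m, 'r) monoid_scheme \<Rightarrow> 'm list \<Rightarrow> 'm" where
  "monoid_prod M xs = foldr (\<lambda>x y. x \<otimes>\<^bsub>M\<^esub> y) xs \<one>\<^bsub>M\<^esub>"

definition submonoid_gen :: "('m, 'r) monoid_scheme \<Rightarrow> 'm set \<Rightarrow> 'm set" where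
  "submonoid_gen M X = {monoid_prod M xs | xs. xs \<in> lists X}"

definition monoid_factorization ::
    "('m, 'r) monoid_scheme \<Rightarrow> 'i::linorder set \<Rightarrow> ('i \<Rightarrow> 'm set) \<Rightarrow> bool" where
  "monoid_factorization M J N \<longleftrightarrow>
     (\<forall>i\<in>J. submonoid (N i) M) \<and>
     (\<forall>m \<in> carrier M - {\<one>\<^bsub>M\<^esub>}. \<exists>!ps.
        sorted_wrt (<) (map fst ps) \<and>
        (\<forall>(i, x) \<in> set ps. i \<in> J \<and> x \<in> N i - {\<one>\<^bsub>M\<^esub>}) \<and>
        m = monoid_prod M (map snd ps))"


section \<open>Free partially commutative monoids\<close>

definition independence_alphabet :: "'a set \<Rightarrow> ('a \<times> 'a) set \<Rightarrow> bool" where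
  "independence_alphabet A \<theta> \<longleftrightarrow> \<theta> \<subseteq> A \<times> A \<and> sym \<theta> \<and> irrefl \<theta>"

text \<open>A trace is the equivalence class of its representing words.  Everything is
  parametrized by the carrier set of the alphabet, so that the same notions apply to an
  alphabet \<open>(Y, \<theta>\<^sub>Y)\<close> whose letters are themselves traces.\<close>

type_synonym 'a trace = "'a list set"

definition swap_step :: "('a \<times> 'a) set \<Rightarrow> ('a list \<times> 'a list) set" where
  "swap_step \<theta> = {(u @ [a, b] @ v, u @ [b, a] @ v) | u v a b. (a, b) \<in> \<theta>}"

definition trace_eq :: "'a set \<Rightarrow> ('a \<times> 'a) set \<Rightarrow> ('a list \<times> 'a list) set" where
  "trace_eq A \<theta> = (swap_step \<theta>)\<^sup>* \<inter> lists A \<times> lists A"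

definition trace_of :: "'a set \<Rightarrow> ('a \<times> 'a) set \<Rightarrow> 'a list \<Rightarrow> 'a trace" where
  "trace_of A \<theta> w = trace_eq A \<theta> `` {w}"

definition trace_monoid :: "'a set \<Rightarrow> ('a \<times> 'a) set \<Rightarrow> 'a trace monoid" where
  "trace_monoid A \<theta> =
     \<lparr>carrier = lists A // trace_eq A \<theta>,
      mult = (\<lambda>s t. \<Union>u\<in>s. \<Union>v\<in>t. trace_of A \<theta> (u @ v)),
      one = trace_of A \<theta> []\<rparr>"

definition letters :: "'a set \<Rightarrow> ('a \<times> 'a) set \<Rightarrow> 'a set \<Rightarrow> 'a trace set" where
  "letters A \<theta> B = (\<lambda>a. trace_of A \<theta> [a]) ` B"

definition Alph :: "'a trace \<Rightarrow> 'a set" where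
  "Alph t = (\<Union>w\<in>t. set w)"

definition IA :: "'a set \<Rightarrow> ('a \<times> 'a) set \<Rightarrow> 'a trace \<Rightarrow> 'a set" where
  "IA A \<theta> t = {a \<in> A. \<exists>w \<in> carrier (trace_monoid A \<theta>).
                        t = trace_of A \<theta> [a] \<otimes>\<^bsub>trace_monoid A \<theta>\<^esub> w}"

definition traces_upto :: "'a set \<Rightarrow> ('a \<times> 'a) set \<Rightarrow> 'a set \<Rightarrow> nat \<Rightarrow> 'a trace set" where
  "traces_upto A \<theta> B n = trace_of A \<theta> ` {w \<in> lists B. length w \<le> n}"


section \<open>Partially commutative codes and transitive bisections\<close>

definition code_indep :: "('a \<times> 'a) set \<Rightarrow> 'a trace set \<Rightarrow> ('a trace \<times> 'a trace) set" where
  "code_indep \<theta> X = {(x, y) \<in> X \<times> X. Alph x \<times> Alph y \<subseteq> \<theta>}"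

text \<open>The map \<open>M(X, \<theta>\<^sub>X) \<rightarrow> M(A, \<theta>)\<close> sending the class of a word over \<open>X\<close> to its product.
  Traces with independent alphabets commute, so all words of a class have the same product.\<close>

definition natural_map :: "'a set \<Rightarrow> ('a \<times> 'a) set \<Rightarrow> 'a trace trace \<Rightarrow> 'a trace" where
  "natural_map A \<theta> c = the_elem (monoid_prod (trace_monoid A \<theta>) ` c)"

definition pc_code :: "'a set \<Rightarrow> ('a \<times> 'a) set \<Rightarrow> 'a trace set \<Rightarrow> bool" where
  "pc_code A \<theta> X \<longleftrightarrow>
     X \<subseteq> carrier (trace_monoid A \<theta>) \<and>
     natural_map A \<theta> \<in> iso (trace_monoid X (code_indep \<theta> X))
       ((trace_monoid A \<theta>)\<lparr>carrier := submonoid_gen (trace_monoid A \<theta>) X\<rparr>)"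

text \<open>\<open>beta A \<theta> B\<close> is \<open>\<beta>\<^sub>Z(B)\<close> for \<open>Z = A - B\<close>; the monoid \<open>M(B, \<theta>\<^sub>B)\<close> is identified with the
  submonoid of \<open>M(A, \<theta>)\<close> generated by the letters in \<open>B\<close>.\<close>

definition beta :: "'a set \<Rightarrow> ('a \<times> 'a) set \<Rightarrow> 'a set \<Rightarrow> 'a trace set" where
  "beta A \<theta> B =
     {t. \<exists>z \<in> A - B. \<exists>w \<in> submonoid_gen (trace_monoid A \<theta>) (letters A \<theta> B).
        t = trace_of A \<theta> [z] \<otimes>\<^bsub>trace_monoid A \<theta>\<^esub> w \<and> IA A \<theta> t = {z}}"

definition tfsa :: "'a set \<Rightarrow> ('a \<times> 'a) set \<Rightarrow> 'a set \<Rightarrow> bool" where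
  "tfsa A \<theta> B \<longleftrightarrow> B \<subseteq> A \<and> pc_code A \<theta> (beta A \<theta> B)"

text \<open>\<open>(P, Q)\<close> is a transitive bisection of \<open>\<langle>Y\<rangle> = M(Y, \<theta>\<^sub>Y)\<close>, where \<open>Y\<close> is a partially
  commutative code in \<open>M(A, \<theta>)\<close>: \<open>P\<close> is a TFSA of the alphabet \<open>(Y, \<theta>\<^sub>Y)\<close>, and \<open>\<beta>\<^sub>Y\<^sub>-\<^sub>P(P)\<close>,
  formed in \<open>M(Y, \<theta>\<^sub>Y)\<close>, is carried to \<open>M(A, \<theta>)\<close> by the natural map.  The case
  \<open>Y = letters A \<theta> A\<close> gives the transitive bisections of \<open>M(A, \<theta>)\<close> itself.\<close>

definition transitive_bisection ::
    "'a set \<Rightarrow> ('a \<times> 'a) set \<Rightarrow> 'a trace set \<Rightarrow> 'a trace set \<times> 'a trace set \<Rightarrow> bool" where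
  "transitive_bisection A \<theta> Y = (\<lambda>(P, Q).
     pc_code A \<theta> Y \<and>
     tfsa Y (code_indep \<theta> Y) P \<and>
     Q = natural_map A \<theta> ` beta Y (code_indep \<theta> Y) P)"


section \<open>Factorizations\<close>

definition trace_factorization ::
    "'a set \<Rightarrow> ('a \<times> 'a) set \<Rightarrow> 'i::linorder set \<Rightarrow> ('i \<Rightarrow> 'a trace set) \<Rightarrow> bool" where
  "trace_factorization A \<theta> J Y \<longleftrightarrow>
     (\<forall>i\<in>J. Y i \<subseteq> carrier (trace_monoid A \<theta>) \<and>
        (\<forall>X. X \<subset> Y i \<longrightarrow>
           submonoid_gen (trace_monoid A \<theta>) X \<noteq> submonoid_gen (trace_monoid A \<theta>) (Y i))) \<and>
     monoid_factorization (trace_monoid A \<theta>) J (\<lambda>i. submonoid_gen (trace_monoid A \<theta>) (Y i))"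

text \<open>A composition \<open>\<bbbB>\<^sub>n \<circ> \<dots> \<circ> \<bbbB>\<^sub>1\<close> of bisections is the list of the \<open>\<bbbB>\<^sub>i\<close> in this order, i.e.
  the last bisection comes first; each one is tagged with the (0-based) position of the
  component that it replaces.  The empty composition is the one-component family \<open>(A)\<close>.\<close>

type_synonym 'a bisections = "(nat \<times> 'a trace set \<times> 'a trace set) list"

primrec composed :: "'a set \<Rightarrow> ('a \<times> 'a) set \<Rightarrow> 'a bisections \<Rightarrow> 'a trace set list" where
  "composed A \<theta> [] = [letters A \<theta> A]"
| "composed A \<theta> (b # f) = (case b of (j, P, Q) \<Rightarrow>
     take j (composed A \<theta> f) @ [P, Q] @ drop (Suc j) (composed A \<theta> f))"

primrec composable :: "'a set \<Rightarrow> ('a \<times> 'a) set \<Rightarrow> 'a bisections \<Rightarrow> bool" where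
  "composable A \<theta> [] \<longleftrightarrow> True"
| "composable A \<theta> (b # f) \<longleftrightarrow> composable A \<theta> f \<and> (case b of (j, P, Q) \<Rightarrow>
     j < length (composed A \<theta> f) \<and> transitive_bisection A \<theta> (composed A \<theta> f ! j) (P, Q))"

definition decompositions ::
    "'a set \<Rightarrow> ('a \<times> 'a) set \<Rightarrow> 'a trace set list \<Rightarrow> 'a bisections set" where
  "decompositions A \<theta> F = {f. f \<noteq> [] \<and> composable A \<theta> f \<and> composed A \<theta> f = F}"

definition finite_transitive_factorization ::
    "'a set \<Rightarrow> ('a \<times> 'a) set \<Rightarrow> 'a trace set list \<Rightarrow> bool" where
  "finite_transitive_factorization A \<theta> F \<longleftrightarrow>
     trace_factorization A \<theta> {..<length F} (\<lambda>i. F ! i) \<and> decompositions A \<theta> F \<noteq> {}"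

definition approximates ::
    "'a set \<Rightarrow> ('a \<times> 'a) set \<Rightarrow> 'i::linorder set \<Rightarrow> ('i \<Rightarrow> 'a trace set) \<Rightarrow>
     'a set \<Rightarrow> nat \<Rightarrow> 'a trace set list \<Rightarrow> bool" where
  "approximates A \<theta> J Y B n F \<longleftrightarrow> (\<exists>\<phi>.
     \<phi> ` {..<length F} \<subseteq> J \<and> strict_mono_on {..<length F} \<phi> \<and>
     (\<forall>i<length F. F ! i \<inter> traces_upto A \<theta> B n = Y (\<phi> i) \<inter> traces_upto A \<theta> B n) \<and>
     (\<forall>j \<in> J - \<phi> ` {..<length F}. Y j \<inter> traces_upto A \<theta> B n = {}))"

definition locally_transitive_finite ::
    "'a set \<Rightarrow> ('a \<times> 'a) set \<Rightarrow> 'i::linorder set \<Rightarrow> ('i \<Rightarrow> 'a trace set) \<Rightarrow> bool" where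
  "locally_transitive_finite A \<theta> J Y \<longleftrightarrow>
     trace_factorization A \<theta> J Y \<and>
     (\<forall>B n. B \<subseteq> A \<longrightarrow> finite B \<longrightarrow>
        (\<exists>F. finite_transitive_factorization A \<theta> F \<and> approximates A \<theta> J Y B n F))"


section \<open>The free partially commutative Lie algebra\<close>

text \<open>The coefficient ring has the sort \<open>{comm_ring, comm_monoid_mult}\<close> rather than
  \<open>comm_ring_1\<close> because the latter excludes the zero ring.\<close>

definition alg_mult ::
    "'a set \<Rightarrow> ('a \<times> 'a) set \<Rightarrow> ('a trace \<Rightarrow>\<^sub>0 'k) \<Rightarrow> ('a trace \<Rightarrow>\<^sub>0 'k) \<Rightarrow>
     ('a trace \<Rightarrow>\<^sub>0 'k::{comm_ring, comm_monoid_mult})" where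
  "alg_mult A \<theta> p q =
     (\<Sum>s\<in>Poly_Mapping.keys p. \<Sum>t\<in>Poly_Mapping.keys q.
        Poly_Mapping.single (s \<otimes>\<^bsub>trace_monoid A \<theta>\<^esub> t)
          (Poly_Mapping.lookup p s * Poly_Mapping.lookup q t))"

definition lie_bracket ::
    "'a set \<Rightarrow> ('a \<times> 'a) set \<Rightarrow> ('a trace \<Rightarrow>\<^sub>0 'k) \<Rightarrow> ('a trace \<Rightarrow>\<^sub>0 'k) \<Rightarrow>
     ('a trace \<Rightarrow>\<^sub>0 'k::{comm_ring, comm_monoid_mult})" where
  "lie_bracket A \<theta> p q = alg_mult A \<theta> p q - alg_mult A \<theta> q p"

inductive_set lie_algebra ::
    "'a set \<Rightarrow> ('a \<times> 'a) set \<Rightarrow> ('a trace \<Rightarrow>\<^sub>0 'k::{comm_ring, comm_monoid_mult}) set"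
  for A :: "'a set" and \<theta> :: "('a \<times> 'a) set" where
  letter: "t \<in> letters A \<theta> A \<Longrightarrow> Poly_Mapping.single t 1 \<in> lie_algebra A \<theta>"
| zero: "0 \<in> lie_algebra A \<theta>"
| add: "p \<in> lie_algebra A \<theta> \<Longrightarrow> q \<in> lie_algebra A \<theta> \<Longrightarrow> p + q \<in> lie_algebra A \<theta>"
| scale: "p \<in> lie_algebra A \<theta> \<Longrightarrow> Poly_Mapping.map (\<lambda>x. c * x) p \<in> lie_algebra A \<theta>"
| bracket: "p \<in> lie_algebra A \<theta> \<Longrightarrow> q \<in> lie_algebra A \<theta> \<Longrightarrow>
    lie_bracket A \<theta> p q \<in> lie_algebra A \<theta>"


section \<open>Bracketings\<close>

text \<open>\<open>bracketing_along A \<theta> f\<close> is the map \<open>\<Pi>\<^sub>f\<close>; it is only meaningful on \<open>\<Union>(set (composed A \<theta> f))\<close>.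
  The factors of \<open>w = y v\<^sub>1 \<dots> v\<^sub>k\<close> are unique up to commutations among the \<open>v\<^sub>i\<close>, and these do
  not change the iterated bracket.  For one bisection of \<open>M(A, \<theta>)\<close> the recursion over the
  empty composition gives \<open>\<Pi>\<^sub>f(z b\<^sub>1 \<dots> b\<^sub>k) = [\<dots>[z, b\<^sub>1], \<dots>, b\<^sub>k]\<close>.\<close>

primrec bracketing_along ::
    "'a set \<Rightarrow> ('a \<times> 'a) set \<Rightarrow> 'a bisections \<Rightarrow> 'a trace \<Rightarrow>
     ('a trace \<Rightarrow>\<^sub>0 'k::{comm_ring, comm_monoid_mult})" where
  "bracketing_along A \<theta> [] = (\<lambda>w. Poly_Mapping.single w 1)"
| "bracketing_along A \<theta> (b # f) = (case b of (j, P, Q) \<Rightarrow> (\<lambda>w.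
     if w \<in> \<Union>(set (composed A \<theta> f)) then bracketing_along A \<theta> f w
     else THE x. \<exists>y vs.
       y \<in> composed A \<theta> f ! j - P \<and> vs \<in> lists P \<and>
       w = monoid_prod (trace_monoid A \<theta>) (y # vs) \<and>
       x = foldl (lie_bracket A \<theta>) (bracketing_along A \<theta> f y)
             (map (bracketing_along A \<theta> f) vs)))"

text \<open>The condition \<open>approximates\<close> ties the finite factorization to the given one on the traces
  of length at most \<open>n\<close> over \<open>B\<close>, so that there the two have the same content and \<open>\<Psi>\<close> is
  constrained on all of it.  Without it, the bisection \<open>(A, {})\<close> of \<open>M(A, \<theta>)\<close> would qualify
  for every \<open>B\<close> and \<open>n\<close>, and nothing but \<open>\<Psi>(a) = a\<close> for the letters would be required.\<close>

definition is_bracketing ::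
    "'a set \<Rightarrow> ('a \<times> 'a) set \<Rightarrow> 'i::linorder set \<Rightarrow> ('i \<Rightarrow> 'a trace set) \<Rightarrow>
     ('a trace \<Rightarrow> ('a trace \<Rightarrow>\<^sub>0 'k::{comm_ring, comm_monoid_mult})) \<Rightarrow> bool" where
  "is_bracketing A \<theta> J Y \<Psi> \<longleftrightarrow>
     (\<forall>t \<in> (\<Union>i\<in>J. Y i). \<Psi> t \<in> lie_algebra A \<theta>) \<and>
     (\<forall>B n. B \<subseteq> A \<longrightarrow> finite B \<longrightarrow>
        (\<exists>F. finite_transitive_factorization A \<theta> F \<and> approximates A \<theta> J Y B n F \<and>
          (\<exists>f \<in> decompositions A \<theta> F.
             \<forall>t \<in> \<Union>(set F) \<inter> traces_upto A \<theta> B n. \<Psi> t = bracketing_along A \<theta> f t)))"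

end

theory Submission
  imports Defs "HOL-Library.Multiset" "HOL-Analysis.Function_Topology"
begin

text \<open>
  The finite approximations of a locally transitive finite factorization are not compatible
  with one another: enlarging \<open>B\<close> or \<open>n\<close> may change the chain of bisections, and with it
  the brackets of short traces.  A bracketing is therefore obtained by compactness.

  The point is that a fixed trace has only finitely many possible brackets.  Whatever
  decomposition \<open>f\<close> is used, \<open>\<Pi>\<^sub>f(t)\<close> is a Lie monomial, that is, a full bracketing
  of some word that represents \<open>t\<close> (lemma \<open>bracketing_along_lie_monomial\<close>); a word has finitely
  many full bracketings (\<open>finite_lie_monomials\<close>) and a trace is a finite set of words.
  So a bracketing is a point of a product of finite discrete spaces, one for each trace
  in the content of the factorization, subject to one condition for each pair \<open>(B, n)\<close>.  That
  condition only concerns the finitely many traces of length at most \<open>n\<close> over \<open>B\<close>, hence is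
  closed.  Finitely many of these conditions hold together: an approximation for the union
  of the sets \<open>B\<close> and an upper bound of the numbers \<open>n\<close> serves for all of
  them (\<open>approximates_antimono\<close>).  By Tychonoff's theorem
  (\<open>compactness_of_local_conditions\<close>) all conditions hold together at some point.

  That \<open>\<Pi>\<^sub>f(t)\<close> is a Lie monomial includes the claim that the definite description
  defining it has exactly one solution.  The factors of \<open>t = y v\<^sub>1 \<dots> v\<^sub>k\<close> are unique up to swaps of
  independent neighbours among the \<open>v\<^sub>i\<close>, because the component that is split is a
  partially commutative code (\<open>code_word_head_unique\<close>).  Independent factors have commuting
  brackets (\<open>independent_lie_monomials_commute\<close>), and by the Jacobi identity commuting elements
  can be exchanged in an iterated bracket (\<open>lie_bracket_swap_commuting\<close>).
\<close>


section \<open>Compactness\<close>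

text \<open>Tychonoff's theorem for finite discrete spaces: each \<open>C i\<close> depends on finitely many
  coordinates only, so it defines a closed subset of the compact product of the sets \<open>V t\<close>, and
  \<open>finitely_satisfiable\<close> is the finite intersection property.\<close>

lemma compactness_of_local_conditions:
  fixes V :: "'a \<Rightarrow> 'b set" and C :: "'i \<Rightarrow> ('a \<Rightarrow> 'b) \<Rightarrow> bool" and S :: "'i \<Rightarrow> 'a set"
  assumes finite_values: "\<And>t. t \<in> T \<Longrightarrow> finite (V t)"
    and finite_support: "\<And>i. i \<in> I \<Longrightarrow> finite (S i)" "\<And>i. i \<in> I \<Longrightarrow> S i \<subseteq> T"
    and local: "\<And>i g h. i \<in> I \<Longrightarrow> (\<And>t. t \<in> S i \<Longrightarrow> g t = h t) \<Longrightarrow> C i g \<Longrightarrow> C i h"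
    and finitely_satisfiable:
      "\<And>K. finite K \<Longrightarrow> K \<subseteq> I \<Longrightarrow> \<exists>g. (\<forall>t\<in>T. g t \<in> V t) \<and> (\<forall>i\<in>K. C i g)"
  shows "\<exists>g. (\<forall>t\<in>T. g t \<in> V t) \<and> (\<forall>i\<in>I. C i g)"
proof -
  define X where "X = product_topology (\<lambda>t. discrete_topology (V t)) T"
  define D where "D i = {g \<in> PiE T V. C i g}" for i
  have top: "topspace X = PiE T V"
    by (simp add: X_def)
  have "compact_space X"
    unfolding X_def compact_space_product_topology compact_space_discrete_topology
    using finite_values by blast
  then have fip: "PiE T V \<inter> \<Inter>\<U> \<noteq> {}"
    if "\<forall>C\<in>\<U>. closedin X C" "\<forall>\<F>. finite \<F> \<and> \<F> \<subseteq> \<U> \<longrightarrow> PiE T V \<inter> \<Inter>\<F> \<noteq> {}" for \<U>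
    using that unfolding compact_space_def top compactin_fip by blast
  have closed: "closedin X (D i)" if i: "i \<in> I" for i
  proof -
    have "openin X (topspace X - D i)"
    proof (subst openin_subopen, intro ballI)
      fix g assume g: "g \<in> topspace X - D i"
      \<comment> \<open>The cylinder of all points that agree with \<open>g\<close> on \<open>S i\<close> is an open neighbourhood of \<open>g\<close>.\<close>
      define U where "U = PiE T (\<lambda>t. if t \<in> S i then {g t} else V t)"
      have "openin X U"
        unfolding X_def U_def openin_PiE_gen
      proof (intro disjI2 conjI ballI)
        show "finite {t \<in> T. (if t \<in> S i then {g t} else V t) \<noteq> topspace (discrete_topology (V t))}"
          by (rule finite_subset[OF _ finite_support(1)[OF i]]) auto
      next
        fix t assume "t \<in> T"
        then show "openin (discrete_topology (V t)) (if t \<in> S i then {g t} else V t)"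
          using g by (auto simp: top PiE_iff)
      qed
      moreover have "g \<in> U"
        using g by (auto simp: U_def top PiE_iff)
      moreover have "h \<in> topspace X - D i" if h: "h \<in> U" for h
      proof -
        have eq: "h t = g t" if "t \<in> S i" for t
          using h that finite_support(2)[OF i] by (auto simp: U_def PiE_iff split: if_splits)
        have "h t \<in> V t" if "t \<in> T" for t
          using h g that by (cases "t \<in> S i") (auto simp: U_def PiE_iff top eq)
        then have hV: "h \<in> PiE T V"
          using h by (auto simp: U_def PiE_iff)
        have "\<not> C i h"
          using g local[of i h g, OF i eq] by (auto simp: top D_def)
        with hV show ?thesis
          by (simp add: D_def top)
      qed
      ultimately show "\<exists>U. openin X U \<and> g \<in> U \<and> U \<subseteq> topspace X - D i"
        by blast
    qed
    then show ?thesis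
      by (auto simp: closedin_def top D_def)
  qed
  have finite_inter: "PiE T V \<inter> \<Inter>\<F> \<noteq> {}" if F: "finite \<F>" "\<F> \<subseteq> D ` I" for \<F>
  proof -
    obtain K where K: "finite K" "K \<subseteq> I" "\<F> = D ` K"
      using finite_subset_image[OF F] by blast
    obtain g where g: "\<forall>t\<in>T. g t \<in> V t" "\<forall>i\<in>K. C i g"
      using finitely_satisfiable[OF K(1,2)] by blast
    \<comment> \<open>Points of the product space are extensional functions, hence the restriction to \<open>T\<close>.\<close>
    have "C i (restrict g T)" if "i \<in> K" for i
    proof (rule local)
      show "i \<in> I" "C i g"
        using that K(2) g(2) by auto
      then show "g t = restrict g T t" if "t \<in> S i" for t
        using that finite_support(2)[of i] by auto
    qed
    then have "restrict g T \<in> PiE T V \<inter> \<Inter>\<F>"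
      using g(1) by (auto simp: K(3) D_def)
    then show ?thesis by blast
  qed
  have "PiE T V \<inter> \<Inter>(D ` I) \<noteq> {}"
    by (rule fip) (use closed finite_inter in blast)+
  then show ?thesis
    by (auto simp: D_def PiE_iff)
qed


section \<open>The monoid of traces\<close>

lemma trace_eq_refl: "u \<in> lists A \<Longrightarrow> (u, u) \<in> trace_eq A \<theta>"
  by (simp add: trace_eq_def)

lemma trace_eq_trans:
  "(u, v) \<in> trace_eq A \<theta> \<Longrightarrow> (v, w) \<in> trace_eq A \<theta> \<Longrightarrow> (u, w) \<in> trace_eq A \<theta>"
  by (auto simp: trace_eq_def)

lemma swap_step_append: "(u, v) \<in> swap_step \<theta> \<Longrightarrow> (x @ u @ y, x @ v @ y) \<in> swap_step \<theta>"
  unfolding swap_step_def by (force intro: exI[of _ "x @ _"])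

lemma swap_steps_append:
  "(u, v) \<in> (swap_step \<theta>)\<^sup>* \<Longrightarrow> (x @ u @ y, x @ v @ y) \<in> (swap_step \<theta>)\<^sup>*"
  by (induction rule: rtrancl_induct) (auto intro: rtrancl_into_rtrancl dest: swap_step_append)

lemma trace_eq_append:
  assumes "(u, u') \<in> trace_eq A \<theta>" "(v, v') \<in> trace_eq A \<theta>"
  shows "(u @ v, u' @ v') \<in> trace_eq A \<theta>"
proof -
  have "(u @ v, u' @ v) \<in> (swap_step \<theta>)\<^sup>*" "(u' @ v, u' @ v') \<in> (swap_step \<theta>)\<^sup>*"
    using assms swap_steps_append[of u u' \<theta> "[]" v] swap_steps_append[of v v' \<theta> u' "[]"]
    by (auto simp: trace_eq_def)
  then show ?thesis
    using assms by (auto simp: trace_eq_def)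
qed

lemma swap_steps_mset: "(u, v) \<in> (swap_step \<theta>)\<^sup>* \<Longrightarrow> mset u = mset v"
  by (induction rule: rtrancl_induct) (auto simp: swap_step_def)

lemma trace_of_self: "u \<in> lists A \<Longrightarrow> u \<in> trace_of A \<theta> u"
  by (simp add: trace_of_def trace_eq_refl)

lemma trace_of_eqD: "trace_of A \<theta> u = trace_of A \<theta> v \<Longrightarrow> v \<in> lists A \<Longrightarrow> (u, v) \<in> trace_eq A \<theta>"
  using trace_of_self[of v A \<theta>] by (auto simp: trace_of_def)

lemma mult_trace_monoid:
  "s \<otimes>\<^bsub>trace_monoid A \<theta>\<^esub> t = {w. \<exists>u\<in>s. \<exists>v\<in>t. (u @ v, w) \<in> trace_eq A \<theta>}"
  by (auto simp: trace_monoid_def trace_of_def)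

lemma one_trace_monoid: "\<one>\<^bsub>trace_monoid A \<theta>\<^esub> = trace_of A \<theta> []"
  by (simp add: trace_monoid_def)

lemma mult_trace_of:
  assumes "u \<in> lists A" "v \<in> lists A"
  shows "trace_of A \<theta> u \<otimes>\<^bsub>trace_monoid A \<theta>\<^esub> trace_of A \<theta> v = trace_of A \<theta> (u @ v)"
  using assms unfolding mult_trace_monoid trace_of_def
  by (auto intro: trace_eq_trans trace_eq_append trace_eq_refl)

text \<open>Associativity is wanted for arbitrary sets of words, as elements of the algebra may have
  any such sets in their support.  It holds because a word with a letter outside \<open>A\<close> is
  equivalent to no word: it contributes nothing to either side.\<close>

lemma mult_trace_assoc:
  "(s \<otimes>\<^bsub>trace_monoid A \<theta>\<^esub> t) \<otimes>\<^bsub>trace_monoid A \<theta>\<^esub> r =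
   s \<otimes>\<^bsub>trace_monoid A \<theta>\<^esub> (t \<otimes>\<^bsub>trace_monoid A \<theta>\<^esub> r)" (is "?L = ?R")
proof -
  have lists: "u \<in> lists A" "v \<in> lists A" if "(u @ v, w) \<in> trace_eq A \<theta>" for u v w
    using that by (auto simp: trace_eq_def)
  have "?L = {w. \<exists>u\<in>s. \<exists>v\<in>t. \<exists>x\<in>r. (u @ v @ x, w) \<in> trace_eq A \<theta>}"
    unfolding mult_trace_monoid
  proof safe
    fix w u v x y assume "u \<in> s" "v \<in> t" "x \<in> r" and 1: "(u @ v, y) \<in> trace_eq A \<theta>"
      and 2: "(y @ x, w) \<in> trace_eq A \<theta>"
    have "((u @ v) @ x, y @ x) \<in> trace_eq A \<theta>"
      by (rule trace_eq_append[OF 1 trace_eq_refl]) (rule lists[OF 2])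
    from trace_eq_trans[OF this 2] \<open>u \<in> s\<close> \<open>v \<in> t\<close> \<open>x \<in> r\<close>
    show "\<exists>u\<in>s. \<exists>v\<in>t. \<exists>x\<in>r. (u @ v @ x, w) \<in> trace_eq A \<theta>" by auto
  next
    fix w u v x assume *: "u \<in> s" "v \<in> t" "x \<in> r" "(u @ v @ x, w) \<in> trace_eq A \<theta>"
    have "(u @ v, u @ v) \<in> trace_eq A \<theta>"
      using lists[of "u @ v" x w] * by (intro trace_eq_refl) auto
    with * show "\<exists>ua\<in>{w. \<exists>u\<in>s. \<exists>v\<in>t. (u @ v, w) \<in> trace_eq A \<theta>}.
        \<exists>v\<in>r. (ua @ v, w) \<in> trace_eq A \<theta>"
      by (intro bexI[of _ "u @ v"] bexI[of _ x]) auto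
  qed
  also have "\<dots> = ?R"
    unfolding mult_trace_monoid
  proof safe
    fix w u v x y assume "u \<in> s" "v \<in> t" "x \<in> r" and 1: "(v @ x, y) \<in> trace_eq A \<theta>"
      and 2: "(u @ y, w) \<in> trace_eq A \<theta>"
    have "(u @ v @ x, u @ y) \<in> trace_eq A \<theta>"
      by (rule trace_eq_append[OF trace_eq_refl 1]) (rule lists[OF 2])
    from trace_eq_trans[OF this 2] \<open>u \<in> s\<close> \<open>v \<in> t\<close> \<open>x \<in> r\<close>
    show "\<exists>u\<in>s. \<exists>v\<in>t. \<exists>x\<in>r. (u @ v @ x, w) \<in> trace_eq A \<theta>" by auto
  next
    fix w u v x assume *: "u \<in> s" "v \<in> t" "x \<in> r" "(u @ v @ x, w) \<in> trace_eq A \<theta>"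
    have "(v @ x, v @ x) \<in> trace_eq A \<theta>"
      using lists[of u "v @ x" w] * by (intro trace_eq_refl) auto
    with * show "\<exists>u\<in>s. \<exists>va\<in>{w. \<exists>u\<in>t. \<exists>v\<in>r. (u @ v, w) \<in> trace_eq A \<theta>}.
        (u @ va, w) \<in> trace_eq A \<theta>"
      by (intro bexI[of _ u] bexI[of _ "v @ x"]) auto
  qed
  finally show ?thesis .
qed

lemma trace_of_commute:
  assumes "independence_alphabet A \<theta>" "(a, b) \<in> \<theta>"
  shows "trace_of A \<theta> [a, b] = trace_of A \<theta> [b, a]"
proof -
  have ab: "a \<in> A" "b \<in> A" "(b, a) \<in> \<theta>"
    using assms by (auto simp: independence_alphabet_def dest: symD)
  have "([x, y], [y, x]) \<in> swap_step \<theta>" if "(x, y) \<in> \<theta>" for x y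
    using that unfolding swap_step_def by force
  then have "([a, b], [b, a]) \<in> trace_eq A \<theta>" "([b, a], [a, b]) \<in> trace_eq A \<theta>"
    using ab assms(2) by (auto simp: trace_eq_def)
  then show ?thesis
    unfolding trace_of_def by (auto intro: trace_eq_trans)
qed

lemma trace_monoid_carrierE:
  assumes "t \<in> carrier (trace_monoid A \<theta>)"
  obtains u where "u \<in> lists A" "t = trace_of A \<theta> u"
proof -
  have "t \<in> lists A // trace_eq A \<theta>"
    using assms by (simp add: trace_monoid_def)
  then show thesis
    by (rule quotientE) (rule that, simp_all add: trace_of_def)
qed

lemma trace_of_carrier: "u \<in> lists A \<Longrightarrow> trace_of A \<theta> u \<in> carrier (trace_monoid A \<theta>)"
  by (auto simp: trace_monoid_def trace_of_def intro: quotientI)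

lemma monoid_prod_trace_of:
  "us \<in> lists (lists A) \<Longrightarrow>
   monoid_prod (trace_monoid A \<theta>) (map (trace_of A \<theta>) us) = trace_of A \<theta> (concat us)"
proof (induction us)
  case Nil
  then show ?case by (simp add: monoid_prod_def one_trace_monoid)
next
  case (Cons u us)
  then have "concat us \<in> lists A" by (fastforce simp: in_lists_conv_set)
  with Cons show ?case by (simp add: monoid_prod_def mult_trace_of)
qed

lemma trace_of_words_set:
  assumes "v \<in> trace_of A \<theta> u"
  shows "set v = set u" "length v = length u"
proof -
  have "mset u = mset v"
    using assms by (auto simp: trace_of_def trace_eq_def dest: swap_steps_mset)
  then show "set v = set u" "length v = length u"
    by (metis mset_eq_setD, metis mset_eq_length)
qed

lemma finite_trace_of: "finite (trace_of A \<theta> u)"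
proof (rule finite_subset)
  show "trace_of A \<theta> u \<subseteq> {v. set v \<subseteq> set u \<and> length v = length u}"
    using trace_of_words_set by fast
  show "finite {v. set v \<subseteq> set u \<and> length v = length u}"
    by (rule finite_lists_length_eq) simp
qed

lemma traces_upto_mono:
  "B \<subseteq> B' \<Longrightarrow> n \<le> n' \<Longrightarrow> traces_upto A \<theta> B n \<subseteq> traces_upto A \<theta> B' n'"
  unfolding traces_upto_def by (intro image_mono) auto

lemma finite_traces_upto: "finite B \<Longrightarrow> finite (traces_upto A \<theta> B n)"
  unfolding traces_upto_def
  by (intro finite_imageI) (simp add: finite_lists_length_le in_lists_conv_set flip: subset_code)


section \<open>The commutator bracket\<close>

lemma poly_mapping_single_induct [case_names zero single add]:
  fixes p :: "'a \<Rightarrow>\<^sub>0 'k::comm_monoid_add"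
  assumes "P 0" "\<And>a c. P (Poly_Mapping.single a c)" "\<And>p q. P p \<Longrightarrow> P q \<Longrightarrow> P (p + q)"
  shows "P p"
proof (induction p rule: Poly_Mapping.update_induct)
  case const
  show ?case by (rule assms(1))
next
  case (update f a b)
  have "Poly_Mapping.update a b f = Poly_Mapping.single a b + f"
    using update(1)
    by (intro poly_mapping_eqI)
      (auto simp: lookup_update lookup_add lookup_single when_def in_keys_iff)
  with assms update show ?case by simp
qed

lemma alg_mult_superset:
  assumes "finite S" "Poly_Mapping.keys p \<subseteq> S" "finite T" "Poly_Mapping.keys q \<subseteq> T"
  shows "alg_mult A \<theta> p q =
     (\<Sum>s\<in>S. \<Sum>t\<in>T. Poly_Mapping.single (s \<otimes>\<^bsub>trace_monoid A \<theta>\<^esub> t)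
          (Poly_Mapping.lookup p s * Poly_Mapping.lookup q t))"
proof -
  have "alg_mult A \<theta> p q = (\<Sum>s\<in>Poly_Mapping.keys p. \<Sum>t\<in>T.
      Poly_Mapping.single (s \<otimes>\<^bsub>trace_monoid A \<theta>\<^esub> t)
          (Poly_Mapping.lookup p s * Poly_Mapping.lookup q t))"
    unfolding alg_mult_def using assms
    by (intro sum.cong refl sum.mono_neutral_left) (auto simp: in_keys_iff)
  also have "\<dots> = (\<Sum>s\<in>S. \<Sum>t\<in>T. Poly_Mapping.single (s \<otimes>\<^bsub>trace_monoid A \<theta>\<^esub> t)
          (Poly_Mapping.lookup p s * Poly_Mapping.lookup q t))"
    using assms by (intro sum.mono_neutral_left) (auto simp: in_keys_iff)
  finally show ?thesis .
qed

lemma alg_mult_single: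
  "alg_mult A \<theta> (Poly_Mapping.single s a) (Poly_Mapping.single t b) =
   Poly_Mapping.single (s \<otimes>\<^bsub>trace_monoid A \<theta>\<^esub> t) (a * b)"
  by (subst alg_mult_superset[of "{s}" _ "{t}"]) auto

lemma alg_mult_add_left: "alg_mult A \<theta> (p + p') q = alg_mult A \<theta> p q + alg_mult A \<theta> p' q"
proof -
  let ?S = "Poly_Mapping.keys p \<union> Poly_Mapping.keys p'" and ?T = "Poly_Mapping.keys q"
  have "Poly_Mapping.keys (p + p') \<subseteq> ?S"
    by (rule Poly_Mapping.keys_add)
  then show ?thesis
    by (simp add: alg_mult_superset[of ?S _ ?T] lookup_add distrib_right single_add sum.distrib)
qed

lemma alg_mult_add_right: "alg_mult A \<theta> p (q + q') = alg_mult A \<theta> p q + alg_mult A \<theta> p q'"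
proof -
  let ?T = "Poly_Mapping.keys q \<union> Poly_Mapping.keys q'" and ?S = "Poly_Mapping.keys p"
  have "Poly_Mapping.keys (q + q') \<subseteq> ?T"
    by (rule Poly_Mapping.keys_add)
  then show ?thesis
    by (simp add: alg_mult_superset[of ?S _ ?T] lookup_add distrib_left single_add sum.distrib)
qed

lemma alg_mult_zero [simp]: "alg_mult A \<theta> 0 q = 0" "alg_mult A \<theta> p 0 = 0"
  by (simp_all add: alg_mult_def)

lemma alg_mult_diff_left: "alg_mult A \<theta> (p - p') q = alg_mult A \<theta> p q - alg_mult A \<theta> p' q"
  using alg_mult_add_left[of A \<theta> "p - p'" p' q] by (simp add: algebra_simps)

lemma alg_mult_diff_right: "alg_mult A \<theta> p (q - q') = alg_mult A \<theta> p q - alg_mult A \<theta> p q'"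
  using alg_mult_add_right[of A \<theta> p "q - q'" q'] by (simp add: algebra_simps)

lemma alg_mult_assoc:
  "alg_mult A \<theta> (alg_mult A \<theta> p q) r = alg_mult A \<theta> p (alg_mult A \<theta> q r)"
proof (induction p rule: poly_mapping_single_induct)
  case (single s a)
  show ?case
  proof (induction q rule: poly_mapping_single_induct)
    case (single t b)
    show ?case
      by (induction r rule: poly_mapping_single_induct)
        (simp_all add: alg_mult_single alg_mult_add_right mult_trace_assoc mult.assoc)
  qed (simp_all add: alg_mult_add_left alg_mult_add_right)
qed (simp_all add: alg_mult_add_left)

text \<open>The Jacobi identity: the two sides differ by \<open>[x, [p, q]]\<close>.\<close>

lemma lie_bracket_swap_commuting:
  assumes "alg_mult A \<theta> p q = alg_mult A \<theta> q p"
  shows "lie_bracket A \<theta> (lie_bracket A \<theta> x p) q = lie_bracket A \<theta> (lie_bracket A \<theta> x q) p"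
proof -
  have "alg_mult A \<theta> x (alg_mult A \<theta> p q) = alg_mult A \<theta> x (alg_mult A \<theta> q p)"
    "alg_mult A \<theta> p (alg_mult A \<theta> q x) = alg_mult A \<theta> q (alg_mult A \<theta> p x)"
    by (simp_all add: assms flip: alg_mult_assoc)
  then show ?thesis
    by (simp add: lie_bracket_def alg_mult_diff_left alg_mult_diff_right alg_mult_assoc algebra_simps)
qed

text \<open>The centralizer of \<open>x\<close> is closed under brackets.\<close>

lemma lie_bracket_commutes:
  assumes "alg_mult A \<theta> x p = alg_mult A \<theta> p x" "alg_mult A \<theta> x q = alg_mult A \<theta> q x"
  shows "alg_mult A \<theta> x (lie_bracket A \<theta> p q) = alg_mult A \<theta> (lie_bracket A \<theta> p q) x"
proof -
  have "alg_mult A \<theta> x (alg_mult A \<theta> p q) = alg_mult A \<theta> (alg_mult A \<theta> p q) x"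
    "alg_mult A \<theta> x (alg_mult A \<theta> q p) = alg_mult A \<theta> (alg_mult A \<theta> q p) x"
    using assms by (metis alg_mult_assoc)+
  then show ?thesis
    by (simp add: lie_bracket_def alg_mult_diff_left alg_mult_diff_right)
qed


section \<open>Lie monomials\<close>

text \<open>The word lists the letters of the bracketing from left to right.  It is kept beside the
  value because the value does not determine it: a bracket may vanish, and the trace
  of the word, not the value, is what has to be compared with the trace that is bracketed.\<close>

inductive lie_monomial ::
    "'a set \<Rightarrow> ('a \<times> 'a) set \<Rightarrow> 'a list \<Rightarrow> ('a trace \<Rightarrow>\<^sub>0 'k::{comm_ring, comm_monoid_mult}) \<Rightarrow> bool"
  for A :: "'a set" and \<theta> :: "('a \<times> 'a) set" where
  letter: "a \<in> A \<Longrightarrow> lie_monomial A \<theta> [a] (Poly_Mapping.single (trace_of A \<theta> [a]) 1)"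
| bracket: "lie_monomial A \<theta> u p \<Longrightarrow> lie_monomial A \<theta> v q \<Longrightarrow>
    lie_monomial A \<theta> (u @ v) (lie_bracket A \<theta> p q)"

lemma lie_monomial_word: "lie_monomial A \<theta> u p \<Longrightarrow> u \<in> lists A \<and> u \<noteq> []"
  by (induction rule: lie_monomial.induct) auto

lemma lie_monomial_in_lie_algebra: "lie_monomial A \<theta> u p \<Longrightarrow> p \<in> lie_algebra A \<theta>"
  by (induction rule: lie_monomial.induct)
    (auto simp: letters_def intro: lie_algebra.letter lie_algebra.bracket)

text \<open>The outermost bracket cuts the word into two nonempty pieces, which leaves finitely many
  choices for the cut and, by induction on the length, for the two halves.\<close>

lemma finite_lie_monomials:
  "finite {p :: 'a trace \<Rightarrow>\<^sub>0 'k::{comm_ring, comm_monoid_mult}. lie_monomial A \<theta> u p}"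
proof (induction u rule: length_induct)
  case (1 u)
  define M :: "'a list \<Rightarrow> ('a trace \<Rightarrow>\<^sub>0 'k) set" where "M v = {p. lie_monomial A \<theta> v p}" for v
  define K where "K = {i. 0 < i \<and> i < length u}"
  have "M u \<subseteq> {Poly_Mapping.single (trace_of A \<theta> u) 1} \<union>
      (\<Union>i\<in>K. (\<lambda>(p, q). lie_bracket A \<theta> p q) ` (M (take i u) \<times> M (drop i u)))"
  proof
    fix p assume "p \<in> M u"
    then have "lie_monomial A \<theta> u p" by (simp add: M_def)
    then show "p \<in> {Poly_Mapping.single (trace_of A \<theta> u) 1} \<union>
      (\<Union>i\<in>K. (\<lambda>(p, q). lie_bracket A \<theta> p q) ` (M (take i u) \<times> M (drop i u)))"
    proof cases
      case (letter a)
      then show ?thesis by simp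
    next
      case (bracket v p1 w p2)
      then have "length v \<in> K" "p1 \<in> M (take (length v) u)" "p2 \<in> M (drop (length v) u)"
        using lie_monomial_word[of A \<theta> v p1] lie_monomial_word[of A \<theta> w p2]
        by (simp_all add: K_def M_def)
      then show ?thesis
        unfolding bracket(2) by (intro UnI2 UN_I image_eqI[where x = "(p1, p2)"]) simp_all
    qed
  qed
  moreover have "finite (M (take i u))" "finite (M (drop i u))" if "i \<in> K" for i
    using 1 that by (auto simp: M_def K_def)
  moreover have "finite K" by (simp add: K_def)
  ultimately show ?case
    unfolding M_def[symmetric] by (elim finite_subset) auto
qed

text \<open>Independent letters commute, and centralizers are closed under brackets; so a
  letter commutes with each independent monomial, and then so does every monomial.\<close>

lemma independent_lie_monomials_commute:
  assumes "independence_alphabet A \<theta>" "lie_monomial A \<theta> u p" "lie_monomial A \<theta> v q"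
    and "set u \<times> set v \<subseteq> \<theta>"
  shows "alg_mult A \<theta> p q = alg_mult A \<theta> q p"
  using assms(2,4)
proof (induction rule: lie_monomial.induct)
  case (letter a)
  from assms(3) letter show ?case
  proof (induction rule: lie_monomial.induct)
    case (letter b)
    then show ?case
      using trace_of_commute[OF assms(1), of a b] by (simp add: alg_mult_single mult_trace_of)
  next
    case (bracket u p v q)
    then show ?case by (intro lie_bracket_commutes) auto
  qed
next
  case (bracket u p u' p')
  have "set u \<times> set v \<subseteq> \<theta>" "set u' \<times> set v \<subseteq> \<theta>"
    using bracket.prems by auto
  from bracket.IH(1)[OF this(1)] bracket.IH(2)[OF this(2)]
  show ?case by (intro lie_bracket_commutes[symmetric]) (rule sym, assumption)+
qed

lemma lie_monomial_foldl:
  assumes "lie_monomial A \<theta> u p" "list_all2 (lie_monomial A \<theta>) us ps"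
  shows "lie_monomial A \<theta> (u @ concat us) (foldl (lie_bracket A \<theta>) p ps)"
  using assms(2,1)
proof (induction arbitrary: u p rule: list_all2_induct)
  case (Cons v us q ps)
  then have "lie_monomial A \<theta> ((u @ v) @ concat us) (foldl (lie_bracket A \<theta>) (lie_bracket A \<theta> p q) ps)"
    by (intro Cons.IH lie_monomial.bracket)
  then show ?case by simp
qed simp


section \<open>Words over a partially commutative code\<close>

text \<open>The class of a one-letter word is a singleton, which gives the values on the letters; the
  natural map of a code is multiplicative, which gives all others.\<close>

lemma natural_map_trace_of:
  assumes code: "pc_code A \<theta> X" and "w \<in> lists X"
  shows "natural_map A \<theta> (trace_of X (code_indep \<theta> X) w) = monoid_prod (trace_monoid A \<theta>) w"
  using assms(2)
proof (induction w)
  case Nil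
  have "w = []" if "([], w) \<in> (swap_step (code_indep \<theta> X))\<^sup>*" for w :: "'a trace list"
    using swap_steps_mset[OF that] by simp
  then have "trace_of X (code_indep \<theta> X) [] = {[]}"
    by (auto simp: trace_of_def trace_eq_def)
  then show ?case by (simp add: natural_map_def)
next
  case (Cons x w)
  let ?X = "trace_monoid X (code_indep \<theta> X)"
  have hom: "natural_map A \<theta> \<in> hom ?X
      ((trace_monoid A \<theta>)\<lparr>carrier := submonoid_gen (trace_monoid A \<theta>) X\<rparr>)"
    using code by (simp add: pc_code_def iso_def)
  have "v = [x]" if "([x], v) \<in> (swap_step (code_indep \<theta> X))\<^sup>*" for v
    using swap_steps_mset[OF that] by simp
  then have "trace_of X (code_indep \<theta> X) [x] = {[x]}"
    using Cons by (auto simp: trace_of_def trace_eq_def)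
  moreover from Cons code have "x \<in> carrier (trace_monoid A \<theta>)"
    by (auto simp: pc_code_def)
  then obtain u where "u \<in> lists A" "x = trace_of A \<theta> u"
    by (rule trace_monoid_carrierE)
  ultimately have x: "natural_map A \<theta> (trace_of X (code_indep \<theta> X) [x]) = x"
    by (simp add: natural_map_def monoid_prod_def one_trace_monoid mult_trace_of)
  have "trace_of X (code_indep \<theta> X) (x # w) =
      trace_of X (code_indep \<theta> X) [x] \<otimes>\<^bsub>?X\<^esub> trace_of X (code_indep \<theta> X) w"
    using Cons by (subst mult_trace_of) auto
  also have "natural_map A \<theta> \<dots> = x \<otimes>\<^bsub>trace_monoid A \<theta>\<^esub> monoid_prod (trace_monoid A \<theta>) w"
    using hom_mult[OF hom, of "trace_of X (code_indep \<theta> X) [x]" "trace_of X (code_indep \<theta> X) w"]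
      Cons x by (simp add: trace_of_carrier)
  finally show ?case by (simp add: monoid_prod_def)
qed

text \<open>This is the injectivity of the natural map, expressed by words.\<close>

lemma pc_code_word_unique:
  assumes code: "pc_code A \<theta> X" and w: "w \<in> lists X" "w' \<in> lists X"
    and eq: "monoid_prod (trace_monoid A \<theta>) w = monoid_prod (trace_monoid A \<theta>) w'"
  shows "(w, w') \<in> (swap_step (code_indep \<theta> X))\<^sup>*"
proof -
  have "inj_on (natural_map A \<theta>) (carrier (trace_monoid X (code_indep \<theta> X)))"
    using code by (auto simp: pc_code_def iso_def bij_betw_def)
  moreover have "natural_map A \<theta> (trace_of X (code_indep \<theta> X) w) =
      natural_map A \<theta> (trace_of X (code_indep \<theta> X) w')"
    using w eq by (simp add: natural_map_trace_of[OF code])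
  ultimately have "trace_of X (code_indep \<theta> X) w = trace_of X (code_indep \<theta> X) w'"
    using w by (auto dest: inj_onD intro: trace_of_carrier)
  from trace_of_eqD[OF this w(2)] show ?thesis
    by (simp add: trace_eq_def)
qed

text \<open>When letters are deleted, a swap of two neighbours either remains a swap or disappears.\<close>

lemma swap_steps_filter:
  "(u, v) \<in> (swap_step \<theta>)\<^sup>* \<Longrightarrow> (filter R u, filter R v) \<in> (swap_step \<theta>)\<^sup>*"
proof (induction rule: rtrancl_induct)
  case (step v w)
  from step(2) obtain x y a b where vw: "v = x @ [a, b] @ y" "w = x @ [b, a] @ y" "(a, b) \<in> \<theta>"
    by (auto simp: swap_step_def)
  have "(filter R v, filter R w) \<in> (swap_step \<theta>)\<^sup>*"
  proof (cases "R a \<and> R b")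
    case True
    then have "(filter R v, filter R w) \<in> swap_step \<theta>"
      using vw unfolding swap_step_def by auto
    then show ?thesis by blast
  next
    case False
    then show ?thesis using vw by auto
  qed
  with step(3) show ?case by simp
qed simp

text \<open>Two factorizations of the same trace differ by swaps.  The head is the only letter outside
  \<open>P\<close>, so keeping the letters outside \<open>P\<close> isolates the heads, and keeping those in \<open>P\<close>
  turns the swaps into swaps between the tails.\<close>

lemma code_word_head_unique:
  assumes "pc_code A \<theta> X" "P \<subseteq> X" "y \<in> X - P" "y' \<in> X - P" "vs \<in> lists P" "vs' \<in> lists P"
    and "monoid_prod (trace_monoid A \<theta>) (y # vs) = monoid_prod (trace_monoid A \<theta>) (y' # vs')"
  shows "y = y'" "(vs, vs') \<in> (swap_step (code_indep \<theta> X))\<^sup>*"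
proof -
  have sw: "(y # vs, y' # vs') \<in> (swap_step (code_indep \<theta> X))\<^sup>*"
    using assms by (intro pc_code_word_unique[of A]) auto
  have "filter (\<lambda>x. x \<in> P) (y # vs) = vs" "filter (\<lambda>x. x \<in> P) (y' # vs') = vs'"
    using assms(3-6) by (auto intro: filter_True)
  then show "(vs, vs') \<in> (swap_step (code_indep \<theta> X))\<^sup>*"
    using swap_steps_filter[OF sw, of "\<lambda>x. x \<in> P"] by simp
  have "filter (\<lambda>x. x \<notin> P) (y # vs) = [y]" "filter (\<lambda>x. x \<notin> P) (y' # vs') = [y']"
    using assms(3-6) by (auto simp: filter_empty_conv)
  then show "y = y'"
    using swap_steps_mset[OF swap_steps_filter[OF sw, of "\<lambda>x. x \<notin> P"]] by simp
qed

text \<open>Existence of the factors to which the bracketing recursion refers.\<close>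

lemma beta_image_factors:
  assumes code: "pc_code A \<theta> X" and "P \<subseteq> X" and "w \<in> natural_map A \<theta> ` beta X (code_indep \<theta> X) P"
  obtains y vs where "y \<in> X - P" "vs \<in> lists P" "w = monoid_prod (trace_monoid A \<theta>) (y # vs)"
proof -
  let ?M = "trace_monoid X (code_indep \<theta> X)" and ?t = "trace_of X (code_indep \<theta> X)"
  from assms(3) obtain y xs where y: "y \<in> X - P" and xs: "xs \<in> lists (letters X (code_indep \<theta> X) P)"
    and w: "w = natural_map A \<theta> (?t [y] \<otimes>\<^bsub>?M\<^esub> monoid_prod ?M xs)"
    by (auto simp: beta_def submonoid_gen_def)
  from xs obtain vs where vs: "vs \<in> lists P" "xs = map (\<lambda>a. ?t [a]) vs"
    unfolding letters_def by (auto simp: lists_image)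
  have "monoid_prod ?M xs = ?t (concat (map (\<lambda>a. [a]) vs))"
    using vs assms(2) monoid_prod_trace_of[of "map (\<lambda>a. [a]) vs" X "code_indep \<theta> X"]
    by (auto simp: comp_def in_lists_conv_set)
  then have "?t [y] \<otimes>\<^bsub>?M\<^esub> monoid_prod ?M xs = ?t (y # vs)"
    using y vs assms(2) by (subst (asm) concat_map_singleton) (auto simp: mult_trace_of in_lists_conv_set subset_iff)
  then have "w = monoid_prod (trace_monoid A \<theta>) (y # vs)"
    using w y vs assms(2) by (auto simp: natural_map_trace_of[OF code] in_lists_conv_set subset_iff)
  with y vs(1) show thesis by (rule that)
qed


section \<open>Bracketings along a decomposition\<close>

lemma composed_Cons_subset:
  assumes "composable A \<theta> ((j, P, Q) # f)" "w \<in> \<Union>(set (composed A \<theta> ((j, P, Q) # f)))"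
  shows "w \<in> \<Union>(set (composed A \<theta> f)) \<or> w \<in> Q"
proof -
  have "P \<subseteq> composed A \<theta> f ! j" "j < length (composed A \<theta> f)"
    using assms(1) by (auto simp: transitive_bisection_def tfsa_def)
  then have "P \<subseteq> \<Union>(set (composed A \<theta> f))"
    by (meson Union_upper nth_mem order_trans)
  then show ?thesis
    using assms(2) by (auto dest: in_set_takeD in_set_dropD)
qed

lemma foldl_bracket_swap_steps:
  assumes sw: "(vs, vs') \<in> (swap_step R)\<^sup>*"
    and comm: "\<And>a b. (a, b) \<in> R \<Longrightarrow> alg_mult A \<theta> (h a) (h b) = alg_mult A \<theta> (h b) (h a)"
  shows "foldl (lie_bracket A \<theta>) x (map h vs) = foldl (lie_bracket A \<theta>) x (map h vs')"
  using sw
proof (induction rule: rtrancl_induct)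
  case (step v w)
  from step(2) obtain r s a b where vw: "v = r @ [a, b] @ s" "w = r @ [b, a] @ s" "(a, b) \<in> R"
    by (auto simp: swap_step_def)
  with step(3) show ?case
    by (simp add: lie_bracket_swap_commuting[OF comm[OF vw(3)]])
qed simp

text \<open>By induction on the decomposition.  For a new element \<open>w = y v\<^sub>1 \<dots> v\<^sub>k\<close> the induction
  hypothesis provides words and Lie monomials for \<open>y\<close> and the \<open>v\<^sub>i\<close>; it thereby shows that
  independent \<open>v\<^sub>i\<close> have commuting brackets, so that the iterated bracket is well
  defined, and the concatenated words represent \<open>w\<close>.\<close>

lemma bracketing_along_lie_monomial:
  assumes ind: "independence_alphabet A \<theta>" and "composable A \<theta> f"
    and "w \<in> \<Union>(set (composed A \<theta> f))"
  shows "\<exists>u. w = trace_of A \<theta> u \<and>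
    lie_monomial A \<theta> u (bracketing_along A \<theta> f w :: _ \<Rightarrow>\<^sub>0 'k::{comm_ring, comm_monoid_mult})"
  using assms(2,3)
proof (induction f arbitrary: w)
  case Nil
  then show ?case by (auto simp: letters_def intro: lie_monomial.letter)
next
  case (Cons b f)
  obtain j P Q where b: "b = (j, P, Q)" by (cases b)
  let ?X = "composed A \<theta> f ! j"
  let ?\<Pi> = "bracketing_along A \<theta> f :: _ \<Rightarrow> _ \<Rightarrow>\<^sub>0 'k"
  have f: "composable A \<theta> f" and j: "j < length (composed A \<theta> f)" and code: "pc_code A \<theta> ?X"
    and P: "P \<subseteq> ?X" and Q: "Q = natural_map A \<theta> ` beta ?X (code_indep \<theta> ?X) P"
    using Cons.prems(1) by (auto simp: b transitive_bisection_def tfsa_def)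
  have X: "?X \<subseteq> \<Union>(set (composed A \<theta> f))"
    using j by (meson Union_upper nth_mem)
  have IH: "\<exists>u. t = trace_of A \<theta> u \<and> lie_monomial A \<theta> u (?\<Pi> t)" if "t \<in> ?X" for t
    using Cons.IH[OF f] that X by blast
  show ?case
  proof (cases "w \<in> \<Union>(set (composed A \<theta> f))")
    case True
    then show ?thesis using Cons.IH[OF f True] by (simp add: b)
  next
    case False
    then have "w \<in> Q"
      using composed_Cons_subset Cons.prems unfolding b by blast
    then obtain y vs where y: "y \<in> ?X - P" and vs: "vs \<in> lists P"
      and w: "w = monoid_prod (trace_monoid A \<theta>) (y # vs)"
      using beta_image_factors[OF code P] unfolding Q by blast
    define x where "x = foldl (lie_bracket A \<theta>) (?\<Pi> y) (map ?\<Pi> vs)"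
    have comm: "alg_mult A \<theta> (?\<Pi> s) (?\<Pi> t) = alg_mult A \<theta> (?\<Pi> t) (?\<Pi> s)"
      if st: "(s, t) \<in> code_indep \<theta> ?X" for s t
    proof -
      from st have "s \<in> ?X" "t \<in> ?X" and alph: "Alph s \<times> Alph t \<subseteq> \<theta>"
        by (simp_all add: code_indep_def)
      obtain u where u: "s = trace_of A \<theta> u" "lie_monomial A \<theta> u (?\<Pi> s)"
        using IH[OF \<open>s \<in> ?X\<close>] by (elim exE conjE)
      obtain v where v: "t = trace_of A \<theta> v" "lie_monomial A \<theta> v (?\<Pi> t)"
        using IH[OF \<open>t \<in> ?X\<close>] by (elim exE conjE)
      have "set u \<subseteq> Alph s" "set v \<subseteq> Alph t"
        using trace_of_self[of u A \<theta>] trace_of_self[of v A \<theta>] u v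
          lie_monomial_word[OF u(2)] lie_monomial_word[OF v(2)]
        unfolding Alph_def by blast+
      with alph have "set u \<times> set v \<subseteq> \<theta>"
        by blast
      with ind u(2) v(2) show ?thesis
        by (rule independent_lie_monomials_commute)
    qed
    have "bracketing_along A \<theta> (b # f) w = (THE x. \<exists>y vs. y \<in> ?X - P \<and> vs \<in> lists P \<and>
       w = monoid_prod (trace_monoid A \<theta>) (y # vs) \<and>
       x = foldl (lie_bracket A \<theta>) (?\<Pi> y) (map ?\<Pi> vs))"
      using False by (simp add: b)
    also have "\<dots> = x"
    proof (rule the_equality)
      fix x' assume "\<exists>y vs. y \<in> ?X - P \<and> vs \<in> lists P \<and>
       w = monoid_prod (trace_monoid A \<theta>) (y # vs) \<and>
       x' = foldl (lie_bracket A \<theta>) (?\<Pi> y) (map ?\<Pi> vs)"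
      then obtain y' vs' where y': "y' \<in> ?X - P" and vs': "vs' \<in> lists P"
       and w': "w = monoid_prod (trace_monoid A \<theta>) (y' # vs')"
       and x': "x' = foldl (lie_bracket A \<theta>) (?\<Pi> y') (map ?\<Pi> vs')" by blast
      note unique = code_word_head_unique[OF code P y y' vs vs' trans[OF sym[OF w] w']]
      show "x' = x"
        unfolding x' x_def unique(1)
        by (rule foldl_bracket_swap_steps[OF unique(2) comm, symmetric])
    next
      show "\<exists>y vs. y \<in> ?X - P \<and> vs \<in> lists P \<and>
       w = monoid_prod (trace_monoid A \<theta>) (y # vs) \<and>
       x = foldl (lie_bracket A \<theta>) (?\<Pi> y) (map ?\<Pi> vs)"
        by (intro exI conjI) (rule y vs w x_def)+
    qed
    finally have val: "bracketing_along A \<theta> (b # f) w = x" .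
    obtain u where u: "y = trace_of A \<theta> u" "lie_monomial A \<theta> u (?\<Pi> y)"
      using IH[OF DiffD1[OF y]] by (elim exE conjE)
    have "\<exists>us. vs = map (trace_of A \<theta>) us \<and> list_all2 (lie_monomial A \<theta>) us (map ?\<Pi> vs)"
      using vs
    proof (induction vs)
      case (Cons v vs)
      then obtain us where "vs = map (trace_of A \<theta>) us" "list_all2 (lie_monomial A \<theta>) us (map ?\<Pi> vs)"
        by auto
      moreover have "v \<in> ?X"
        using Cons P by auto
      moreover obtain u where "v = trace_of A \<theta> u" "lie_monomial A \<theta> u (?\<Pi> v)"
        using IH[OF calculation(3)] by (elim exE conjE)
      ultimately show ?case
        by (intro exI[of _ "u # us"]) simp
    qed simp
    then obtain us where us: "vs = map (trace_of A \<theta>) us"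
      "list_all2 (lie_monomial A \<theta>) us (map ?\<Pi> vs)" by blast
    have monomial: "lie_monomial A \<theta> (u @ concat us) x"
      unfolding x_def by (rule lie_monomial_foldl[OF u(2) us(2)])
    then have "u # us \<in> lists (lists A)"
      using lie_monomial_word[OF monomial] by (auto simp: in_lists_conv_set)
    then have "w = trace_of A \<theta> (u @ concat us)"
      using monoid_prod_trace_of[of "u # us" A \<theta>] w u(1) us(1) by simp
    with monomial show ?thesis
      unfolding val by (intro exI conjI)
  qed
qed


section \<open>Bracketings of locally transitive finite factorizations\<close>

text \<open>The factorization and its approximation have the same short traces.  This makes the condition
  on a bracketing at \<open>(B, n)\<close> depend only on its values on the finitely many elements
  of the factorization in \<open>B\<^sup>\<le>\<^sup>n\<close>, whichever approximation is chosen.\<close>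

lemma approximates_content:
  assumes "approximates A \<theta> J Y B n F"
  shows "\<Union>(set F) \<inter> traces_upto A \<theta> B n = (\<Union>i\<in>J. Y i) \<inter> traces_upto A \<theta> B n"
proof -
  from assms obtain \<phi> where \<phi>: "\<phi> ` {..<length F} \<subseteq> J"
    and eq: "\<forall>i<length F. F ! i \<inter> traces_upto A \<theta> B n = Y (\<phi> i) \<inter> traces_upto A \<theta> B n"
    and out: "\<forall>j \<in> J - \<phi> ` {..<length F}. Y j \<inter> traces_upto A \<theta> B n = {}"
    unfolding approximates_def by (elim exE conjE)
  have "\<Union>(set F) = (\<Union>i<length F. F ! i)"
    by (auto simp: set_conv_nth)
  then have "\<Union>(set F) \<inter> traces_upto A \<theta> B n = (\<Union>i<length F. F ! i \<inter> traces_upto A \<theta> B n)"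
    by auto
  also have "\<dots> = (\<Union>i<length F. Y (\<phi> i) \<inter> traces_upto A \<theta> B n)"
    using eq by simp
  also have "\<dots> = (\<Union>i\<in>J. Y i \<inter> traces_upto A \<theta> B n)"
    using \<phi> out by blast
  finally show ?thesis by auto
qed

text \<open>Approximations for larger data serve for smaller ones: this makes the
  conditions at the various \<open>(B, n)\<close> directed.\<close>

lemma approximates_antimono:
  assumes "approximates A \<theta> J Y B' n' F" "B \<subseteq> B'" "n \<le> n'"
  shows "approximates A \<theta> J Y B n F"
proof -
  have restrict: "S \<inter> traces_upto A \<theta> B n = (S \<inter> traces_upto A \<theta> B' n') \<inter> traces_upto A \<theta> B n" for S
    using traces_upto_mono[OF assms(2,3), of A \<theta>] by blast
  from assms(1) obtain \<phi> where \<phi>: "\<phi> ` {..<length F} \<subseteq> J" "strict_mono_on {..<length F} \<phi>"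
    and eq: "\<forall>i<length F. F ! i \<inter> traces_upto A \<theta> B' n' = Y (\<phi> i) \<inter> traces_upto A \<theta> B' n'"
    and out: "\<forall>j \<in> J - \<phi> ` {..<length F}. Y j \<inter> traces_upto A \<theta> B' n' = {}"
    unfolding approximates_def by (elim exE conjE)
  have "F ! i \<inter> traces_upto A \<theta> B n = Y (\<phi> i) \<inter> traces_upto A \<theta> B n" if "i < length F" for i
    using eq that restrict[of "F ! i"] restrict[of "Y (\<phi> i)"] by simp
  moreover have "Y j \<inter> traces_upto A \<theta> B n = {}" if "j \<in> J - \<phi> ` {..<length F}" for j
    using out that restrict[of "Y j"] by simp
  ultimately show ?thesis
    using \<phi> unfolding approximates_def by blast
qed

theorem theorem25:
  fixes A :: "'a set" and \<theta> :: "('a \<times> 'a) set"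
    and J :: "'i::linorder set" and Y :: "'i \<Rightarrow> 'a trace set"
  assumes "independence_alphabet A \<theta>"
    and "locally_transitive_finite A \<theta> J Y"
  shows "\<exists>\<Psi> :: 'a trace \<Rightarrow> ('a trace \<Rightarrow>\<^sub>0 'k::{comm_ring, comm_monoid_mult}).
           is_bracketing A \<theta> J Y \<Psi>"
proof -
  define T where "T = (\<Union>i\<in>J. Y i)"
  \<comment> \<open>The finite set of possible brackets of \<open>t\<close>.\<close>
  define V :: "'a trace \<Rightarrow> ('a trace \<Rightarrow>\<^sub>0 'k) set" where
    "V t = (\<Union>u\<in>t. {p. lie_monomial A \<theta> u p})" for t
  define I where "I = {(B, n :: nat). B \<subseteq> A \<and> finite B}"
  define S where "S = (\<lambda>(B, n). T \<inter> traces_upto A \<theta> B n)"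
  \<comment> \<open>The condition that a bracketing has to satisfy at \<open>(B, n)\<close>.\<close>
  define C :: "'a set \<times> nat \<Rightarrow> ('a trace \<Rightarrow> ('a trace \<Rightarrow>\<^sub>0 'k)) \<Rightarrow> bool" where
    "C = (\<lambda>(B, n) \<Psi>. \<exists>F. finite_transitive_factorization A \<theta> F \<and> approximates A \<theta> J Y B n F \<and>
          (\<exists>f \<in> decompositions A \<theta> F.
             \<forall>t \<in> \<Union>(set F) \<inter> traces_upto A \<theta> B n. \<Psi> t = bracketing_along A \<theta> f t))"
  have T: "T \<subseteq> carrier (trace_monoid A \<theta>)"
    using assms(2) by (auto simp: T_def locally_transitive_finite_def trace_factorization_def)
  have approx: "\<exists>F f. finite_transitive_factorization A \<theta> F \<and> approximates A \<theta> J Y B n F \<and>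
      f \<in> decompositions A \<theta> F" if "B \<subseteq> A" "finite B" for B n
    using assms(2) that unfolding locally_transitive_finite_def finite_transitive_factorization_def
    by blast
  have in_V: "bracketing_along A \<theta> f t \<in> V t"
    if f: "f \<in> decompositions A \<theta> F" and t: "t \<in> \<Union>(set F)" for f F t
  proof -
    have "composable A \<theta> f" "t \<in> \<Union>(set (composed A \<theta> f))"
      using f t by (auto simp: decompositions_def)
    from bracketing_along_lie_monomial[OF assms(1) this, where ?'k = 'k]
    obtain u where u: "t = trace_of A \<theta> u"
      "lie_monomial A \<theta> u (bracketing_along A \<theta> f t :: _ \<Rightarrow>\<^sub>0 'k)" by blast
    with lie_monomial_word[OF u(2)] trace_of_self[of u A \<theta>] show ?thesis
      by (auto simp: V_def)
  qed
  \<comment> \<open>The approximation at the alphabet and the length of \<open>t\<close> contains \<open>t\<close>, so it brackets \<open>t\<close>.\<close>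
  have V_nonempty: "V t \<noteq> {}" if t: "t \<in> T" for t
  proof -
    from t T obtain u where u: "u \<in> lists A" "t = trace_of A \<theta> u"
      by (blast elim: trace_monoid_carrierE)
    have "t \<in> traces_upto A \<theta> (set u) (length u)"
      using u by (auto simp: traces_upto_def)
    moreover obtain F f where "approximates A \<theta> J Y (set u) (length u) F" "f \<in> decompositions A \<theta> F"
      using approx[of "set u" "length u"] u by (auto simp: in_lists_conv_set)
    ultimately show ?thesis
      using in_V[of f F t] approximates_content t unfolding T_def by blast
  qed
  have "\<exists>\<Psi>. (\<forall>t\<in>T. \<Psi> t \<in> V t) \<and> (\<forall>i\<in>I. C i \<Psi>)"
  proof (rule compactness_of_local_conditions[where S = S])
    fix t assume "t \<in> T"
    then obtain u where "t = trace_of A \<theta> u"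
      using T by (blast elim: trace_monoid_carrierE)
    then show "finite (V t)"
      by (auto simp: V_def intro: finite_trace_of finite_lie_monomials)
  next
    fix i assume "i \<in> I"
    then show "finite (S i)" "S i \<subseteq> T"
      by (auto simp: I_def S_def intro: finite_traces_upto)
  next
    fix i g h assume "i \<in> I" and gh: "\<And>t. t \<in> S i \<Longrightarrow> g t = h t" and "C i g"
    obtain B n where i: "i = (B, n)" by (cases i)
    from \<open>C i g\<close> obtain F f where F: "finite_transitive_factorization A \<theta> F"
      "approximates A \<theta> J Y B n F" "f \<in> decompositions A \<theta> F"
      "\<forall>t \<in> \<Union>(set F) \<inter> traces_upto A \<theta> B n. g t = bracketing_along A \<theta> f t"
      unfolding C_def i by auto
    have "h t = bracketing_along A \<theta> f t" if "t \<in> \<Union>(set F) \<inter> traces_upto A \<theta> B n" for t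
    proof -
      have "t \<in> S i"
        using that unfolding approximates_content[OF F(2)] by (simp add: S_def i T_def)
      with that gh F(4) show ?thesis by metis
    qed
    with F(1-3) show "C i h" unfolding C_def i case_prod_conv by blast
  next
    fix K assume K: "finite K" "K \<subseteq> I"
    define B where "B = (\<Union>(B, n)\<in>K. B)"
    \<comment> \<open>The sum is an upper bound of the lengths that also makes sense for \<open>K = {}\<close>.\<close>
    define n where "n = (\<Sum>(B, n)\<in>K. n)"
    have "B \<subseteq> A" "finite B"
      using K by (auto simp: B_def I_def)
    then obtain F f where F: "finite_transitive_factorization A \<theta> F" "approximates A \<theta> J Y B n F"
      and f: "f \<in> decompositions A \<theta> F"
      using approx by blast
    \<comment> \<open>Elements of \<open>T\<close> outside the approximation get an arbitrary possible bracket.\<close>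
    define g where "g t = (if t \<in> \<Union>(set F) then bracketing_along A \<theta> f t else SOME p. p \<in> V t)"
      for t
    have "g t \<in> V t" if "t \<in> T" for t
      using in_V[OF f, of t] V_nonempty[OF that] by (auto simp: g_def some_in_eq)
    moreover have "C i g" if i: "i \<in> K" for i
    proof -
      obtain B' n' where i': "i = (B', n')" by (cases i)
      have "B' \<subseteq> B" using i i' by (auto simp: B_def)
      moreover have "n' \<le> n"
        using member_le_sum[of i K snd] i i' K(1) by (simp add: n_def case_prod_unfold)
      ultimately have "approximates A \<theta> J Y B' n' F"
        by (rule approximates_antimono[OF F(2)])
      with F(1) f show ?thesis by (auto simp: C_def i' g_def)
    qed
    ultimately show "\<exists>g. (\<forall>t\<in>T. g t \<in> V t) \<and> (\<forall>i\<in>K. C i g)" by blast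
  qed
  then obtain \<Psi> where \<Psi>: "\<forall>t\<in>T. \<Psi> t \<in> V t" "\<forall>i\<in>I. C i \<Psi>" by blast
  have "\<Psi> t \<in> lie_algebra A \<theta>" if "t \<in> T" for t
    using \<Psi>(1) that by (auto simp: V_def dest!: bspec intro: lie_monomial_in_lie_algebra)
  moreover have "C (B, n) \<Psi>" if "B \<subseteq> A" "finite B" for B n
    using \<Psi>(2) that by (auto simp: I_def)
  ultimately have "is_bracketing A \<theta> J Y \<Psi>"
    unfolding is_bracketing_def C_def T_def by simp
  then show ?thesis by blast
qed

end
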